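(* Let the likelihood be in the exponential family $p(y\mid z)=h(y)\exp(T(y)^\top\phi(z)-A(z))$ with $A(z)=\log\int h(y)\exp(T(y)^\top\phi(z))\,dy$ and $\phi$ one-to-one, and let the prior be $p(z)=s(z\mid\xi_0)$ in the corresponding conjugate family $$s(z\mid\xi)=\exp\!\left(\xi^\top\begin{bmatrix}\phi(z)\\-A(z)\end{bmatrix}-B(\xi)\right),\qquad B(\xi)=\log\int\exp\!\left(\xi^\top\begin{bmatrix}\phi(z)\\-A(z)\end{bmatrix}\right)dz .$$ Let $\mathcal{D},\mathcal{D}^*$ be datasets, let $K\ge1$, let $z_1,\dots,z_K$ be i.i.d. samples from the exact posterior $p(z\mid\mathcal{D})$, and let $R_K=\frac1K\sum_{k=1}^Kp(\mathcal{D}^*\mid z_k)$. Then $$\mathrm{SNR}(R_K)=\frac{\sqrt K}{\sqrt{\exp(\delta)^2-1}},$$ where $$\delta=\tfrac12\mathrm{KL}\big(s(z\mid\xi_{\mathcal{D}+\mathcal{D}^*})\,\|\,s(z\mid\xi_{\mathcal{D}})\big)+\tfrac12\mathrm{KL}\big(s(z\mid\xi_{\mathcal{D}+\mathcal{D}^*})\,\|\,s(z\mid\xi_{\mathcal{D}+2\mathcal{D}^*})\big)=\frac{B(\xi_{\mathcal{D}})+B(\xi_{\mathcal{D}+2\mathcal{D}^*})}{2}-B(\xi_{\mathcal{D}+\mathcal{D}^*}),$$ and for any dataset $\mathcal{D}$, $\xi_{\mathcal{D}}=\xi_0+\begin{bmatrix}\sum_{y\in\mathcal{D}}T(y)\\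|\mathcal{D}|\end{bmatrix}$.
   Context: Datasets are finite multisets: $\mathcal{D}+\mathcal{D}^*$ is multiset addition, $2\mathcal{D}^*=\mathcal{D}^*+\mathcal{D}^*$, $|\mathcal{D}|$ is the number of elements with multiplicity, and $p(\mathcal{D}\mid z)=\prod_{y\in\mathcal{D}}p(y\mid z)$. The posterior is $p(z\mid\mathcal{D})\propto p(\mathcal{D}\mid z)p(z)$, which equals $s(z\mid\xi_{\mathcal{D}})$. It is assumed that $B$ is finite at $\xi_0,\xi_{\mathcal{D}},\xi_{\mathcal{D}+\mathcal{D}^*},\xi_{\mathcal{D}+2\mathcal{D}^*}$ and that $h(y)>0$ for the data points. $\mathrm{SNR}(R)=\mathbb{E}[R]/\sqrt{\mathbb{V}[R]}$ ($\mathbb V$ the variance), read as $+\infty$ when $\mathbb{V}[R]=0$ (equivalently $\delta=0$). $\mathrm{KL}(a\|b)=\int a(z)\log\frac{a(z)}{b(z)}\,dz$. *)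

theory Defs
  imports "HOL-Probability.Probability"
begin

text \<open>
  The integrals over \<open>y\<close> and \<open>z\<close> are taken with respect to reference measures \<open>N\<close> (data) and
  \<open>M\<close> (latent variable); \<open>lborel\<close>, its restriction to a Borel set, and counting measures are
  instances. The stacked vectors of length \<open>n + 1\<close> live in the product \<open>'n \<times> real\<close>, whose inner
  product is the sum of the componentwise ones.
\<close>

definition log_integral :: "'a measure \<Rightarrow> ('a \<Rightarrow> real) \<Rightarrow> real" where
  "log_integral M f = ln (\<integral>x. f x \<partial>M)"

text \<open>For measurable \<open>f \<ge> 0\<close> this says that the integral lies strictly between 0 and infinity, so
  that \<open>log_integral M f\<close> is not a default value.\<close>

definition log_integral_finite :: "'a measure \<Rightarrow> ('a \<Rightarrow> real) \<Rightarrow> bool" where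
  "log_integral_finite M f \<longleftrightarrow> integrable M f \<and> 0 < (\<integral>x. f x \<partial>M)"

definition lik_kernel ::
  "('y \<Rightarrow> real) \<Rightarrow> ('y \<Rightarrow> 'n::euclidean_space) \<Rightarrow> ('z \<Rightarrow> 'n) \<Rightarrow> 'z \<Rightarrow> 'y \<Rightarrow> real" where
  "lik_kernel h T \<phi> z y = h y * exp (T y \<bullet> \<phi> z)"

definition lik_A ::
  "'y measure \<Rightarrow> ('y \<Rightarrow> real) \<Rightarrow> ('y \<Rightarrow> 'n::euclidean_space) \<Rightarrow> ('z \<Rightarrow> 'n) \<Rightarrow> 'z \<Rightarrow> real" where
  "lik_A N h T \<phi> z = log_integral N (lik_kernel h T \<phi> z)"

definition lik ::
  "'y measure \<Rightarrow> ('y \<Rightarrow> real) \<Rightarrow> ('y \<Rightarrow> 'n::euclidean_space) \<Rightarrow> ('z \<Rightarrow> 'n) \<Rightarrow> 'y \<Rightarrow> 'z \<Rightarrow> real" where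
  "lik N h T \<phi> y z = h y * exp (T y \<bullet> \<phi> z - lik_A N h T \<phi> z)"

definition data_lik ::
  "'y measure \<Rightarrow> ('y \<Rightarrow> real) \<Rightarrow> ('y \<Rightarrow> 'n::euclidean_space) \<Rightarrow> ('z \<Rightarrow> 'n) \<Rightarrow>
    'y multiset \<Rightarrow> 'z \<Rightarrow> real" where
  "data_lik N h T \<phi> D z = (\<Prod>y\<in>#D. lik N h T \<phi> y z)"

text \<open>In the conjugate family, \<open>\<phi>\<close> and \<open>A\<close> are the functions of \<open>z\<close> from the likelihood.\<close>

definition conj_kernel ::
  "('z \<Rightarrow> 'n::euclidean_space) \<Rightarrow> ('z \<Rightarrow> real) \<Rightarrow> 'n \<times> real \<Rightarrow> 'z \<Rightarrow> real" where
  "conj_kernel \<phi> A \<xi> z = exp (\<xi> \<bullet> (\<phi> z, - A z))"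

definition conj_B ::
  "'z measure \<Rightarrow> ('z \<Rightarrow> 'n::euclidean_space) \<Rightarrow> ('z \<Rightarrow> real) \<Rightarrow> 'n \<times> real \<Rightarrow> real" where
  "conj_B M \<phi> A \<xi> = log_integral M (conj_kernel \<phi> A \<xi>)"

definition conj_density ::
  "'z measure \<Rightarrow> ('z \<Rightarrow> 'n::euclidean_space) \<Rightarrow> ('z \<Rightarrow> real) \<Rightarrow> 'n \<times> real \<Rightarrow> 'z \<Rightarrow> real" where
  "conj_density M \<phi> A \<xi> z = exp (\<xi> \<bullet> (\<phi> z, - A z) - conj_B M \<phi> A \<xi>)"

definition conj_param ::
  "('y \<Rightarrow> 'n::euclidean_space) \<Rightarrow> 'n \<times> real \<Rightarrow> 'y multiset \<Rightarrow> 'n \<times> real" where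
  "conj_param T \<xi>0 D = \<xi>0 + ((\<Sum>y\<in>#D. T y), real (size D))"

definition posterior ::
  "'z measure \<Rightarrow> ('z \<Rightarrow> real) \<Rightarrow> ('z \<Rightarrow> real) \<Rightarrow> 'z \<Rightarrow> real" where
  "posterior M L prior z = L z * prior z / (\<integral>z'. L z' * prior z' \<partial>M)"

definition kl_integrand :: "('z \<Rightarrow> real) \<Rightarrow> ('z \<Rightarrow> real) \<Rightarrow> 'z \<Rightarrow> real" where
  "kl_integrand a b z = a z * ln (a z / b z)"

definition kl_div :: "'z measure \<Rightarrow> ('z \<Rightarrow> real) \<Rightarrow> ('z \<Rightarrow> real) \<Rightarrow> real" where
  "kl_div M a b = (\<integral>z. kl_integrand a b z \<partial>M)"

text \<open>The library's divergence takes the measures in the opposite order.\<close>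

lemma kl_div_eq_KL_divergence:
  assumes "sigma_finite_measure M"
    and "a \<in> borel_measurable M" "b \<in> borel_measurable M"
    and "\<And>z. 0 < a z" "\<And>z. 0 < b z"
  shows "kl_div M a b = KL_divergence (exp 1) (density M b) (density M a)"
proof -
  interpret sigma_finite_measure M by fact
  have "b z \<noteq> 0" for z using assms(5)[of z] by simp
  then show ?thesis
    using assms
    by (subst KL_density_density)
      (auto simp: kl_div_def kl_integrand_def log_def less_imp_le)
qed

text \<open>The same convention is built into division on \<open>ereal\<close>: \<open>x / 0 = \<infinity>\<close> for \<open>x > 0\<close>.\<close>

definition snr :: "'w measure \<Rightarrow> ('w \<Rightarrow> real) \<Rightarrow> ereal" where
  "snr P X = (if prob_space.variance P X = 0 then \<infinity>
     else ereal (prob_space.expectation P X / sqrt (prob_space.variance P X)))"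

end

theory Submission
  imports Defs
begin

text \<open>
  Multiplying the density of the conjugate family at \<open>\<xi>\<^bsub>D\<^esub>\<close> by the likelihood of a dataset \<open>E\<close> gives,
  up to an explicit constant, the unnormalised density at \<open>\<xi>\<^bsub>D+E\<^esub>\<close>. Taking \<open>E = D*\<close> and \<open>E = 2D*\<close>,
  this yields the first two moments of \<open>p(D*|z)\<close> under the posterior in terms of \<open>B\<close>, so that the
  squared ratio of standard deviation to mean of one sample is
  \<open>exp (B(\<xi>\<^bsub>D\<^esub>) + B(\<xi>\<^bsub>D+2D*\<^esub>) - 2 B(\<xi>\<^bsub>D+D*\<^esub>)) - 1\<close>; averaging \<open>K\<close> independent samples divides it by \<open>K\<close>.
  In the sum of the two divergences the expected sufficient statistics cancel, because
  \<open>\<xi>\<^bsub>D+D*\<^esub>\<close> is the midpoint of \<open>\<xi>\<^bsub>D\<^esub>\<close> and \<open>\<xi>\<^bsub>D+2D*\<^esub>\<close>.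
\<close>

section \<open>Variance of a sum of independent variables\<close>

text \<open>Induction on \<open>I\<close>: the new variable is independent of the sum of the others,
  so the mean of the cross product factors and cancels in the variance. Square integrability belongs
  to the claim because \<open>variance_eq\<close> needs it for that sum.\<close>

lemma (in prob_space) variance_sum_indep:
  fixes X :: "'i \<Rightarrow> 'a \<Rightarrow> real"
  assumes "finite I" and "indep_vars (\<lambda>_. borel) X I"
    and "\<And>i. i \<in> I \<Longrightarrow> integrable M (X i)"
    and "\<And>i. i \<in> I \<Longrightarrow> integrable M (\<lambda>\<omega>. (X i \<omega>)\<^sup>2)"
  shows "integrable M (\<lambda>\<omega>. (\<Sum>i\<in>I. X i \<omega>)\<^sup>2)
    \<and> variance (\<lambda>\<omega>. \<Sum>i\<in>I. X i \<omega>) = (\<Sum>i\<in>I. variance (X i))"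
  using assms
proof (induction I rule: finite_induct)
  case empty
  then show ?case by simp
next
  case (insert j I)
  let ?S = "\<lambda>\<omega>. \<Sum>i\<in>I. X i \<omega>"
  have IH: "integrable M (\<lambda>\<omega>. (?S \<omega>)\<^sup>2)" "variance ?S = (\<Sum>i\<in>I. variance (X i))"
    using insert.IH[OF indep_vars_subset[OF insert.prems(1)]] insert.prems(2,3) by auto
  have S: "integrable M ?S" and X: "integrable M (X j)" and X2: "integrable M (\<lambda>\<omega>. (X j \<omega>)\<^sup>2)"
    using insert.prems by (auto intro!: Bochner_Integration.integrable_sum)
  have ind: "indep_var borel (X j) borel ?S"
    using indep_vars_sum[OF insert.hyps insert.prems(1)] .
  note XS = indep_var_integrable[OF ind X S] and EXS = indep_var_lebesgue_integral[OF ind X S]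
  have eq: "(X j \<omega> + ?S \<omega>)\<^sup>2 = (X j \<omega>)\<^sup>2 + (?S \<omega>)\<^sup>2 + 2 * (X j \<omega> * ?S \<omega>)" for \<omega>
    by (simp add: power2_sum)
  have int2: "integrable M (\<lambda>\<omega>. (X j \<omega> + ?S \<omega>)\<^sup>2)"
    unfolding eq using X2 IH(1) XS
    by (intro Bochner_Integration.integrable_add integrable_mult_right) auto
  have "expectation (\<lambda>\<omega>. (X j \<omega> + ?S \<omega>)\<^sup>2)
      = expectation (\<lambda>\<omega>. (X j \<omega>)\<^sup>2) + expectation (\<lambda>\<omega>. (?S \<omega>)\<^sup>2)
        + 2 * (expectation (X j) * expectation ?S)"
    unfolding eq EXS[symmetric] using X2 IH(1) XS by simp
  moreover have "expectation (\<lambda>\<omega>. X j \<omega> + ?S \<omega>) = expectation (X j) + expectation ?S"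
    using X S by (rule Bochner_Integration.integral_add)
  moreover have "integrable M (\<lambda>\<omega>. X j \<omega> + ?S \<omega>)"
    using X S by (rule Bochner_Integration.integrable_add)
  ultimately have "variance (\<lambda>\<omega>. X j \<omega> + ?S \<omega>) = variance (X j) + variance ?S"
    unfolding variance_eq[OF X X2] variance_eq[OF S IH(1)]
    using variance_eq[OF _ int2] by (simp only: power2_sum)
  then show ?case
    using insert.hyps int2 IH(2) by simp
qed

section \<open>Conjugate updates and the exact posterior\<close>

text \<open>Each data point adds \<open>T y\<close> to the coefficient of \<open>\<phi> z\<close>
  and 1 to that of \<open>- A z\<close>, whence the last coordinate counts the points.\<close>

lemma data_lik_eq_kernel:
  "data_lik N h T \<phi> E z
    = (\<Prod>y\<in>#E. h y) * conj_kernel \<phi> (lik_A N h T \<phi>) (\<Sum>y\<in>#E. T y, real (size E)) z"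
  by (induction E)
    (simp_all add: data_lik_def conj_kernel_def lik_def inner_add_left algebra_simps flip: exp_add)

lemma data_lik_union: "data_lik N h T \<phi> (E + F) z = data_lik N h T \<phi> E z * data_lik N h T \<phi> F z"
  by (simp add: data_lik_def)

lemma conj_kernel_pos: "0 < conj_kernel \<phi> A \<eta> z"
  by (simp add: conj_kernel_def)

lemma conj_kernel_add: "conj_kernel \<phi> A (\<eta> + \<zeta>) z = conj_kernel \<phi> A \<eta> z * conj_kernel \<phi> A \<zeta> z"
  by (simp add: conj_kernel_def inner_add_left exp_add)

lemma conj_param_empty: "conj_param T \<xi>0 {#} = \<xi>0"
  by (simp add: conj_param_def flip: zero_prod_def)

lemma conj_param_union:
  "conj_param T \<xi>0 (D + E) = conj_param T \<xi>0 D + (\<Sum>y\<in>#E. T y, real (size E))"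
  by (simp add: conj_param_def add.assoc)

lemma conj_density_eq_kernel:
  "conj_density M \<phi> A \<eta> z = exp (- conj_B M \<phi> A \<eta>) * conj_kernel \<phi> A \<eta> z"
  by (simp add: conj_density_def conj_kernel_def flip: exp_add)

lemma exp_conj_B:
  "log_integral_finite M (conj_kernel \<phi> A \<eta>) \<Longrightarrow>
    exp (conj_B M \<phi> A \<eta>) = (\<integral>z. conj_kernel \<phi> A \<eta> z \<partial>M)"
  by (simp add: conj_B_def log_integral_def log_integral_finite_def)

lemma integral_conj_density:
  assumes "log_integral_finite M (conj_kernel \<phi> A \<eta>)"
  shows "integrable M (conj_density M \<phi> A \<eta>)" and "(\<integral>z. conj_density M \<phi> A \<eta> z \<partial>M) = 1"
  using assms exp_conj_B[OF assms]
  by (auto simp: conj_density_eq_kernel[abs_def] log_integral_finite_def exp_minus simp flip: exp_conj_B)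

lemma kernel_mult_data_lik:
  "conj_kernel \<phi> (lik_A N h T \<phi>) (conj_param T \<xi>0 D) z * data_lik N h T \<phi> E z
    = (\<Prod>y\<in>#E. h y) * conj_kernel \<phi> (lik_A N h T \<phi>) (conj_param T \<xi>0 (D + E)) z"
  by (simp add: data_lik_eq_kernel conj_param_union conj_kernel_add)

text \<open>The numerator and the normalising integral share the constant \<open>c\<close> below. It
  is nonzero because \<open>h\<close> is nonzero on \<open>D\<close>, so it cancels and leaves the
  kernel divided by its integral.\<close>

lemma posterior_eq_conj_density:
  assumes A: "A = lik_A N h T \<phi>"
    and h: "\<And>y. y \<in># D \<Longrightarrow> h y \<noteq> 0"
    and fin: "log_integral_finite M (conj_kernel \<phi> A (conj_param T \<xi>0 D))"
  shows "posterior M (data_lik N h T \<phi> D) (conj_density M \<phi> A \<xi>0)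
    = conj_density M \<phi> A (conj_param T \<xi>0 D)"
proof
  fix z
  define c where "c = (\<Prod>y\<in>#D. h y) * exp (- conj_B M \<phi> A \<xi>0)"
  have c: "c \<noteq> 0" using h by (auto simp: c_def prod_mset_zero_iff)
  have eq: "data_lik N h T \<phi> D z * conj_density M \<phi> A \<xi>0 z
      = c * conj_kernel \<phi> A (conj_param T \<xi>0 D) z" for z
    \<comment> \<open>The prior is treated as the member of the family updated by the empty
      dataset.\<close>
    using kernel_mult_data_lik[of \<phi> N h T \<xi>0 "{#}" z D]
    by (simp add: c_def A conj_density_eq_kernel mult_ac conj_param_empty)
  show "posterior M (data_lik N h T \<phi> D) (conj_density M \<phi> A \<xi>0) z
      = conj_density M \<phi> A (conj_param T \<xi>0 D) z"
    unfolding posterior_def eq using c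
    by (simp add: conj_density_eq_kernel exp_minus exp_conj_B[OF fin] divide_inverse mult.commute)
qed

section \<open>Moments of the likelihood under the posterior\<close>

lemma expectation_data_lik:
  assumes A: "A = lik_A N h T \<phi>"
    and X: "distributed P M X (\<lambda>z. ennreal (conj_density M \<phi> A (conj_param T \<xi>0 D) z))"
    and D: "log_integral_finite M (conj_kernel \<phi> A (conj_param T \<xi>0 D))"
    and DE: "log_integral_finite M (conj_kernel \<phi> A (conj_param T \<xi>0 (D + E)))"
  shows "data_lik N h T \<phi> E \<in> borel_measurable M"
    and "integrable P (\<lambda>\<omega>. data_lik N h T \<phi> E (X \<omega>))"
    and "(\<integral>\<omega>. data_lik N h T \<phi> E (X \<omega>) \<partial>P)
      = (\<Prod>y\<in>#E. h y) * exp (conj_B M \<phi> A (conj_param T \<xi>0 (D + E)) - conj_B M \<phi> A (conj_param T \<xi>0 D))"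
proof -
  let ?k = "\<lambda>D. conj_kernel \<phi> A (conj_param T \<xi>0 D)"
  let ?s = "conj_density M \<phi> A (conj_param T \<xi>0 D)"
  have int: "integrable M (?k D)" "integrable M (?k (D + E))"
    using D DE by (auto simp: log_integral_finite_def)
  \<comment> \<open>Measurability of the likelihood comes from writing it as a multiple of a
    quotient of two kernels, each measurable because it is integrable.\<close>
  have "?k D z \<noteq> 0" for z
    using conj_kernel_pos[of \<phi> A _ z] by (metis less_irrefl)
  then have "data_lik N h T \<phi> E = (\<lambda>z. (\<Prod>y\<in>#E. h y) * ?k (D + E) z / ?k D z)"
    using kernel_mult_data_lik[of \<phi> N h T \<xi>0 D _ E] by (simp add: A fun_eq_iff field_simps)
  then show meas: "data_lik N h T \<phi> E \<in> borel_measurable M"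
    using int[THEN borel_measurable_integrable] by simp
  have eq: "?s z * data_lik N h T \<phi> E z
      = (\<Prod>y\<in>#E. h y) * exp (- conj_B M \<phi> A (conj_param T \<xi>0 D)) * ?k (D + E) z" for z
    using kernel_mult_data_lik[of \<phi> N h T \<xi>0 D z E] by (simp add: A conj_density_eq_kernel)
  have "0 \<le> ?s z" for z
    by (simp add: conj_density_def)
  note distr = distributed_integrable[OF X meas this] distributed_integral[OF X meas this]
  show "integrable P (\<lambda>\<omega>. data_lik N h T \<phi> E (X \<omega>))"
    unfolding distr(1)[symmetric] eq using int(2) by simp
  show "(\<integral>\<omega>. data_lik N h T \<phi> E (X \<omega>) \<partial>P)
      = (\<Prod>y\<in>#E. h y) * exp (conj_B M \<phi> A (conj_param T \<xi>0 (D + E)) - conj_B M \<phi> A (conj_param T \<xi>0 D))"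
    unfolding distr(2)[symmetric] eq
    by (simp add: exp_conj_B[OF DE, symmetric] flip: exp_add)
qed

section \<open>Divergences within the conjugate family\<close>

text \<open>With \<open>x\<close> the change of the exponent along \<open>v\<close>, this is what
  bounds the linear part of the divergence at the middle parameter by the kernels at the two outer
  ones.\<close>

lemma abs_mult_exp_le: "\<bar>x\<bar> * exp x \<le> 1 + exp (2 * x)" for x :: real
proof -
  have "\<bar>x\<bar> \<le> exp (- x) + exp x"
    using exp_ge_add_one_self[of x] exp_ge_add_one_self[of "- x"] exp_gt_zero[of x] exp_gt_zero[of "- x"]
    by linarith
  then have "\<bar>x\<bar> * exp x \<le> (exp (- x) + exp x) * exp x"
    by (intro mult_right_mono) auto
  also have "\<dots> = 1 + exp (2 * x)"
    by (simp add: distrib_right flip: exp_add)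
  finally show ?thesis .
qed

lemma integrable_conj_density_inner:
  assumes "integrable M (conj_kernel \<phi> A \<eta>)" "integrable M (conj_kernel \<phi> A (\<eta> + v))"
    "integrable M (conj_kernel \<phi> A (\<eta> + v + v))"
  shows "integrable M (\<lambda>z. conj_density M \<phi> A (\<eta> + v) z * (v \<bullet> (\<phi> z, - A z)))"
proof -
  let ?x = "\<lambda>z. v \<bullet> (\<phi> z, - A z)"
  \<comment> \<open>As a logarithm of a quotient of integrable kernels, \<open>?x\<close> is
    measurable.\<close>
  have "?x = (\<lambda>z. ln (conj_kernel \<phi> A (\<eta> + v) z / conj_kernel \<phi> A \<eta> z))"
    by (simp add: fun_eq_iff conj_kernel_def inner_add_left flip: exp_diff)
  then have [measurable]: "?x \<in> borel_measurable M"
    using assms(1,2)[THEN borel_measurable_integrable] by simp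
  have "integrable M (\<lambda>z. conj_kernel \<phi> A (\<eta> + v) z * ?x z)"
  proof (rule Bochner_Integration.integrable_bound)
    show "integrable M (\<lambda>z. conj_kernel \<phi> A \<eta> z + conj_kernel \<phi> A (\<eta> + v + v) z)"
      using assms by simp
    show "(\<lambda>z. conj_kernel \<phi> A (\<eta> + v) z * ?x z) \<in> borel_measurable M"
      using assms(2)[THEN borel_measurable_integrable] by measurable
    have "\<bar>conj_kernel \<phi> A (\<eta> + v) z * ?x z\<bar> \<le> conj_kernel \<phi> A \<eta> z + conj_kernel \<phi> A (\<eta> + v + v) z" for z
    proof -
      \<comment> \<open>Multiplying the kernel at \<open>\<eta>\<close> by \<open>exp (?x z)\<close>
        shifts its parameter by \<open>v\<close>, and by \<open>exp (2 * ?x z)\<close> shifts it by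
        \<open>v + v\<close>.\<close>
      have "conj_kernel \<phi> A \<eta> z * (\<bar>?x z\<bar> * exp (?x z)) \<le> conj_kernel \<phi> A \<eta> z * (1 + exp (2 * ?x z))"
        by (intro mult_left_mono abs_mult_exp_le less_imp_le[OF conj_kernel_pos])
      then show ?thesis
        by (simp add: conj_kernel_def abs_mult inner_add_left exp_add exp_double power2_eq_square
            algebra_simps)
    qed
    then show "AE z in M. norm (conj_kernel \<phi> A (\<eta> + v) z * ?x z)
        \<le> norm (conj_kernel \<phi> A \<eta> z + conj_kernel \<phi> A (\<eta> + v + v) z)"
      by (auto intro: order_trans[OF _ abs_ge_self])
  qed
  then show ?thesis
    by (simp add: conj_density_eq_kernel mult.assoc)
qed

text \<open>The log ratio of two members is linear in \<open>(\<phi> z, - A z)\<close> plus a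
  constant, and the constant integrates to itself against a density of total mass 1. Integrability
  of the linear part lets the integral be split.\<close>

lemma kl_div_conj_density:
  assumes fin: "log_integral_finite M (conj_kernel \<phi> A \<eta>)"
    and int: "integrable M (\<lambda>z. conj_density M \<phi> A \<eta> z * ((\<eta> - \<zeta>) \<bullet> (\<phi> z, - A z)))"
  shows "integrable M (kl_integrand (conj_density M \<phi> A \<eta>) (conj_density M \<phi> A \<zeta>))"
    and "kl_div M (conj_density M \<phi> A \<eta>) (conj_density M \<phi> A \<zeta>)
      = (\<integral>z. conj_density M \<phi> A \<eta> z * ((\<eta> - \<zeta>) \<bullet> (\<phi> z, - A z)) \<partial>M)
        + (conj_B M \<phi> A \<zeta> - conj_B M \<phi> A \<eta>)"
proof -
  have eq: "kl_integrand (conj_density M \<phi> A \<eta>) (conj_density M \<phi> A \<zeta>)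
      = (\<lambda>z. conj_density M \<phi> A \<eta> z * ((\<eta> - \<zeta>) \<bullet> (\<phi> z, - A z))
          + (conj_B M \<phi> A \<zeta> - conj_B M \<phi> A \<eta>) * conj_density M \<phi> A \<eta> z)"
    by (auto simp: fun_eq_iff kl_integrand_def conj_density_def inner_diff_left algebra_simps
        simp flip: exp_diff)
  show "integrable M (kl_integrand (conj_density M \<phi> A \<eta>) (conj_density M \<phi> A \<zeta>))"
    unfolding eq using int integral_conj_density(1)[OF fin] by simp
  show "kl_div M (conj_density M \<phi> A \<eta>) (conj_density M \<phi> A \<zeta>)
      = (\<integral>z. conj_density M \<phi> A \<eta> z * ((\<eta> - \<zeta>) \<bullet> (\<phi> z, - A z)) \<partial>M)
        + (conj_B M \<phi> A \<zeta> - conj_B M \<phi> A \<eta>)"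
    unfolding kl_div_def eq using int integral_conj_density[OF fin] by simp
qed

text \<open>The first two claims ensure that the divergences in the third are integrals that exist,
  not the default value \<open>0\<close>.\<close>

lemma conj_kl_midpoint:
  fixes \<phi> :: "'z \<Rightarrow> 'n::euclidean_space"
  assumes fin: "log_integral_finite M (conj_kernel \<phi> A \<eta>)"
    "log_integral_finite M (conj_kernel \<phi> A (\<eta> + v))"
    "log_integral_finite M (conj_kernel \<phi> A (\<eta> + v + v))"
  defines "s \<equiv> conj_density M \<phi> A" and "B \<equiv> conj_B M \<phi> A"
  shows "integrable M (kl_integrand (s (\<eta> + v)) (s \<eta>))"
    and "integrable M (kl_integrand (s (\<eta> + v)) (s (\<eta> + v + v)))"
    and "kl_div M (s (\<eta> + v)) (s \<eta>) + kl_div M (s (\<eta> + v)) (s (\<eta> + v + v))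
      = B \<eta> + B (\<eta> + v + v) - 2 * B (\<eta> + v)"
proof -
  let ?m = "\<lambda>z. s (\<eta> + v) z * (v \<bullet> (\<phi> z, - A z))"
  have int: "integrable M ?m"
    using integrable_conj_density_inner[of M \<phi> A \<eta> v] fin by (simp add: s_def log_integral_finite_def)
  \<comment> \<open>Opposite displacements: both divergences contain the integral of
    \<open>?m\<close>, with opposite signs.\<close>
  have eq: "\<eta> + v - \<eta> = v" "\<eta> + v - (\<eta> + v + v) = - v"
    by simp_all
  note kl0 = kl_div_conj_density[of M \<phi> A "\<eta> + v" \<eta>, folded s_def B_def, unfolded eq inner_minus_left mult_minus_right]
    and kl2 = kl_div_conj_density[of M \<phi> A "\<eta> + v" "\<eta> + v + v", folded s_def B_def, unfolded eq inner_minus_left mult_minus_right]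
  show "integrable M (kl_integrand (s (\<eta> + v)) (s \<eta>))"
    using kl0(1) fin int by simp
  show "integrable M (kl_integrand (s (\<eta> + v)) (s (\<eta> + v + v)))"
    using kl2(1) fin int by simp
  show "kl_div M (s (\<eta> + v)) (s \<eta>) + kl_div M (s (\<eta> + v)) (s (\<eta> + v + v))
      = B \<eta> + B (\<eta> + v + v) - 2 * B (\<eta> + v)"
    using kl0(2) kl2(2) fin int by simp
qed

section \<open>Signal-to-noise ratio of an average of independent samples\<close>

text \<open>Writing the second moment as \<open>q * m\<^sup>2\<close> gives each term the variance
  \<open>(q - 1) * m\<^sup>2\<close>, so the scale \<open>m\<close> drops out of the ratio.
  Identical distribution enters only through the common first two moments.\<close>

lemma snr_mean_iid:
  fixes L :: "nat \<Rightarrow> 'w \<Rightarrow> real"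
  assumes "prob_space P" and K: "1 \<le> K"
    and indep: "prob_space.indep_vars P (\<lambda>_. borel) L {1..K}"
    and int: "\<And>k. k \<in> {1..K} \<Longrightarrow> integrable P (L k)"
    and int2: "\<And>k. k \<in> {1..K} \<Longrightarrow> integrable P (\<lambda>\<omega>. (L k \<omega>)\<^sup>2)"
    and E: "\<And>k. k \<in> {1..K} \<Longrightarrow> (\<integral>\<omega>. L k \<omega> \<partial>P) = m"
    and E2: "\<And>k. k \<in> {1..K} \<Longrightarrow> (\<integral>\<omega>. (L k \<omega>)\<^sup>2 \<partial>P) = q * m\<^sup>2"
    and m: "0 < m"
  defines "R \<equiv> \<lambda>\<omega>. 1 / real K * (\<Sum>k=1..K. L k \<omega>)"
  shows "integrable P R" and "integrable P (\<lambda>\<omega>. (R \<omega>)\<^sup>2)"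
    and "snr P R = ereal (sqrt (real K)) / ereal (sqrt (q - 1))"
proof -
  interpret prob_space P by fact
  let ?S = "\<lambda>\<omega>. \<Sum>k=1..K. L k \<omega>"
  have sum: "integrable P (\<lambda>\<omega>. (?S \<omega>)\<^sup>2)" "variance ?S = (\<Sum>k=1..K. variance (L k))"
    using variance_sum_indep[OF _ indep int int2] by auto
  have intS: "integrable P ?S"
    using int by (intro Bochner_Integration.integrable_sum) auto
  show "integrable P R"
    unfolding R_def using intS by (rule integrable_mult_right)
  show "integrable P (\<lambda>\<omega>. (R \<omega>)\<^sup>2)"
    unfolding R_def power_mult_distrib using sum(1) by (rule integrable_mult_right)
  have "variance (L k) = (q - 1) * m\<^sup>2" if "k \<in> {1..K}" for k
    using variance_eq[OF int[OF that] int2[OF that]] by (simp only: E E2 that algebra_simps)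
  then have varS: "variance ?S = real K * ((q - 1) * m\<^sup>2)"
    unfolding sum(2) by simp
  have "variance R = (1 / real K)\<^sup>2 * variance ?S"
    by (simp only: R_def integral_mult_right_zero power_mult_distrib flip: right_diff_distrib)
  also have "\<dots> = (q - 1) * m\<^sup>2 / real K"
    unfolding varS using K by (simp add: power2_eq_square)
  finally have var: "variance R = (q - 1) * m\<^sup>2 / real K" .
  have ex: "expectation R = m"
    unfolding R_def integral_mult_right_zero using int E K
    by (subst Bochner_Integration.integral_sum) auto
  \<comment> \<open>A variance is nonnegative, so the root below is taken of a nonnegative
    number.\<close>
  have q: "0 \<le> q - 1"
    using variance_positive[of R] m K by (simp add: var zero_le_divide_iff zero_le_mult_iff)
  show "snr P R = ereal (sqrt (real K)) / ereal (sqrt (q - 1))"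
  \<comment> \<open>For \<open>q = 1\<close> the variance vanishes: the left side is infinite by
    definition, the right side because a positive \<open>ereal\<close> is divided by 0;
    \<open>1 \<le> K\<close> makes the numerator positive.\<close>
  proof (cases "q = 1")
    case True
    then show ?thesis using K by (simp add: snr_def var)
  next
    case False
    then show ?thesis
      unfolding snr_def var using q m K
      by (simp add: ex real_sqrt_mult real_sqrt_divide)
  qed
qed

section \<open>From moments and divergences to the formula\<close>

theorem mainTheorem2:
  fixes N :: "'y measure" and M :: "'z measure" and P :: "'w measure"
    and h :: "'y \<Rightarrow> real" and T :: "'y \<Rightarrow> 'n::euclidean_space" and \<phi> :: "'z \<Rightarrow> 'n"
    and A :: "'z \<Rightarrow> real" and B :: "'n \<times> real \<Rightarrow> real"
    and s :: "'n \<times> real \<Rightarrow> 'z \<Rightarrow> real"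
    and \<xi>0 :: "'n \<times> real" and \<xi> :: "'y multiset \<Rightarrow> 'n \<times> real"
    and D Dstar :: "'y multiset"
    and K :: nat and Z :: "nat \<Rightarrow> 'w \<Rightarrow> 'z" and R :: "'w \<Rightarrow> real"
    and \<delta> :: real
  assumes "sigma_finite_measure N" and "sigma_finite_measure M"
    and "h \<in> borel_measurable N" and "T \<in> borel_measurable N" and "\<phi> \<in> borel_measurable M"
    and "\<And>y. y \<in> space N \<Longrightarrow> 0 \<le> h y"
    and "inj_on \<phi> (space M)"
    and "\<And>z. z \<in> space M \<Longrightarrow> log_integral_finite N (lik_kernel h T \<phi> z)"
    and A: "A = lik_A N h T \<phi>"
    and B: "B = conj_B M \<phi> A"
    and s: "s = conj_density M \<phi> A"
    and \<xi>: "\<xi> = conj_param T \<xi>0"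
    and "set_mset D \<subseteq> space N" and "set_mset Dstar \<subseteq> space N"
    and "\<And>y. y \<in># D + Dstar \<Longrightarrow> 0 < h y"
    and "\<And>\<eta>. \<eta> \<in> {\<xi>0, \<xi> D, \<xi> (D + Dstar), \<xi> (D + (Dstar + Dstar))} \<Longrightarrow>
           log_integral_finite M (conj_kernel \<phi> A \<eta>)"
    and "1 \<le> K"
    and "prob_space P"
    and "prob_space.indep_vars P (\<lambda>_. M) Z {1..K}"
    and "\<And>k. k \<in> {1..K} \<Longrightarrow>
           distributed P M (Z k) (\<lambda>z. ennreal (posterior M (data_lik N h T \<phi> D) (s \<xi>0) z))"
    and R: "R = (\<lambda>\<omega>. 1 / real K * (\<Sum>k=1..K. data_lik N h T \<phi> Dstar (Z k \<omega>)))"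
    and \<delta>: "\<delta> = 1/2 * kl_div M (s (\<xi> (D + Dstar))) (s (\<xi> D))
            + 1/2 * kl_div M (s (\<xi> (D + Dstar))) (s (\<xi> (D + (Dstar + Dstar))))"
  shows "integrable P R \<and> integrable P (\<lambda>\<omega>. (R \<omega>)\<^sup>2)
    \<and> integrable M (kl_integrand (s (\<xi> (D + Dstar))) (s (\<xi> D)))
    \<and> integrable M (kl_integrand (s (\<xi> (D + Dstar))) (s (\<xi> (D + (Dstar + Dstar)))))
    \<and> snr P R = ereal (sqrt (real K)) / ereal (sqrt ((exp \<delta>)\<^sup>2 - 1))
    \<and> \<delta> = (B (\<xi> D) + B (\<xi> (D + (Dstar + Dstar)))) / 2 - B (\<xi> (D + Dstar))"
proof (intro conjI)
  let ?p = "data_lik N h T \<phi>"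
  \<comment> \<open>The parameter increment caused by one copy of \<open>Dstar\<close>; the three
    parameters are then in arithmetic progression.\<close>
  define v where "v = (\<Sum>y\<in>#Dstar. T y, real (size Dstar))"
  have \<xi>1: "\<xi> (D + Dstar) = \<xi> D + v" and \<xi>2: "\<xi> (D + (Dstar + Dstar)) = \<xi> D + v + v"
    by (simp_all add: \<xi> v_def conj_param_union flip: add.assoc)
  have fin: "log_integral_finite M (conj_kernel \<phi> A (\<xi> D))"
    "log_integral_finite M (conj_kernel \<phi> A (\<xi> (D + Dstar)))"
    "log_integral_finite M (conj_kernel \<phi> A (\<xi> (D + (Dstar + Dstar))))"
    using assms(16) by blast+
  note kl = conj_kl_midpoint[of M \<phi> A "\<xi> D" v, folded s B \<xi>1 \<xi>2, folded \<xi>2, OF fin]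
  show "integrable M (kl_integrand (s (\<xi> (D + Dstar))) (s (\<xi> D)))"
    and "integrable M (kl_integrand (s (\<xi> (D + Dstar))) (s (\<xi> (D + (Dstar + Dstar)))))"
    by (fact kl(1), fact kl(2))
  show \<delta>B: "\<delta> = (B (\<xi> D) + B (\<xi> (D + (Dstar + Dstar)))) / 2 - B (\<xi> (D + Dstar))"
    using kl(3) unfolding \<delta> by (simp add: field_simps)

  have "posterior M (?p D) (s \<xi>0) = s (\<xi> D)"
    unfolding s \<xi> A using assms(15) fin(1)
    by (intro posterior_eq_conj_density[OF refl]) (force simp: A \<xi>)+
  then have Z: "distributed P M (Z k) (\<lambda>z. ennreal (s (\<xi> D) z))" if "k \<in> {1..K}" for k
    using assms(20)[OF that] by simp
  note moment = expectation_data_lik[OF A, of P M _ \<xi>0 D, folded \<xi>, folded s B, OF Z fin(1)]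
  define c where "c = (\<Prod>y\<in>#Dstar. h y)"
  define m where "m = c * exp (B (\<xi> (D + Dstar)) - B (\<xi> D))"
  have "0 < c"
    using assms(15) unfolding c_def by (induction Dstar) auto
  then have m: "0 < m"
    by (simp add: m_def)
  \<comment> \<open>Turns the second moment for \<open>Dstar\<close> into a first moment for the
    doubled dataset.\<close>
  have sq: "(?p Dstar z)\<^sup>2 = ?p (Dstar + Dstar) z" for z
    by (simp add: data_lik_union power2_eq_square)
  \<comment> \<open>Identifies the factor \<open>q\<close> of \<open>snr_mean_iid\<close>: twice
    \<open>\<delta>\<close> is exactly the exponent left when the second moment is divided by
    \<open>m\<^sup>2\<close>.\<close>
  have E2: "(exp \<delta>)\<^sup>2 * m\<^sup>2 = c * c * exp (B (\<xi> (D + (Dstar + Dstar))) - B (\<xi> D))"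
    by (simp add: \<delta>B m_def power_mult_distrib power2_eq_square field_simps flip: exp_add)
  have "prob_space.indep_vars P (\<lambda>_. borel) (\<lambda>k \<omega>. ?p Dstar (Z k \<omega>)) {1..K}"
    by (rule prob_space.indep_vars_compose2[OF assms(18,19)]) (rule moment(1)[OF _ fin(2)])
  note snr = snr_mean_iid[OF \<open>prob_space P\<close> \<open>1 \<le> K\<close> this, of m "(exp \<delta>)\<^sup>2"]
  have *: "integrable P (\<lambda>\<omega>. ?p Dstar (Z k \<omega>))"
    "integrable P (\<lambda>\<omega>. (?p Dstar (Z k \<omega>))\<^sup>2)"
    "(\<integral>\<omega>. ?p Dstar (Z k \<omega>) \<partial>P) = m"
    "(\<integral>\<omega>. (?p Dstar (Z k \<omega>))\<^sup>2 \<partial>P) = (exp \<delta>)\<^sup>2 * m\<^sup>2" if "k \<in> {1..K}" for k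
    using moment(2,3)[OF that fin(2)] moment(2,3)[OF that fin(3)]
    by (simp_all add: sq E2) (simp_all add: m_def c_def)
  show "integrable P R" "integrable P (\<lambda>\<omega>. (R \<omega>)\<^sup>2)"
    "snr P R = ereal (sqrt (real K)) / ereal (sqrt ((exp \<delta>)\<^sup>2 - 1))"
    unfolding R using snr[OF * m] by simp_all
qed

end
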